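(* Let $a\in\mathcal{A}$. Then the following are equivalent: (1) $a$ has a generalized right group decomposition, i.e., there exist $a_1,a_2\in\mathcal{A}$ with $a=a_1+a_2$, $a_1^*a_2=a_2a_1=0$, $a_1\in\mathcal{A}_r^{\#}$, $a_2\in\mathcal{A}^{qnil}$. (2) There exists $x\in\mathcal{A}$ such that $x=ax^2$, $(a^*a^2x)^*=a^*a^2x$, $\lim_{n\to\infty}\|a^n-axa^n\|^{1/n}=0$. (3) $a\in\mathcal{A}_r^{d}$ and there exists $x\in\mathcal{A}$ such that $x=ax^2$, $(aa_r^d)^*a^2x=(aa_r^d)^*a$, $\lim_{n\to\infty}\|a^n-axa^n\|^{1/n}=0$.
   Context: $\mathcal{A}$ is a unital complex Banach $*$-algebra, i.e. a unital complex Banach algebra with an involution satisfying $(x+y)^*=x^*+y^*$, $(\lambda x)^*=\overline{\lambda}x^*$, $(xy)^*=y^*x^*$, $(x^* )^*=x$; the involution is assumed proper: $x^*x=0$ implies $x=0$. $\mathcal{A}^{qnil}=\{x\in\mathcal{A}:\lim_{n\to\infty}\|x^n\|^{1/n}=0\}$. $\mathcal{A}_r^{\#}$ is the set of right group invertible elements: $a\in\mathcal{A}_r^{\#}$ iff there is $x\in\mathcal{A}$ with $ax^2=x$ and $a^2x=axa=a$. $\mathcal{A}_r^{d}$ is the set of elements having a generalized right Drazin inverse: $a\in\mathcal{A}_r^d$ iff there is $x\in\mathcal{A}$ with $ax^2=x$, $a^2x=axa$, $a-axa\in\mathcal{A}^{qnil}$. For $a\in\mathcal{A}_r^d$, $a_r^d$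 denotes a generalized right Drazin inverse of $a$, i.e. an (arbitrarily fixed) element $x$ with $ax^2=x=xax$, $a^2x=axa$, $a-axa\in\mathcal{A}^{qnil}$ (such an element exists whenever $a\in\mathcal{A}_r^d$). *)

theory Defs
  imports "HOL-Analysis.Analysis"
begin

text \<open>
  HOL-Analysis only has real normed algebras. A complex one is a real one together with a
  complex scalar multiplication that extends the real one; the unit has norm 1, as usual
  for unital Banach algebras.
\<close>

class complex_banach_algebra_1 = real_normed_algebra_1 + banach +
  fixes scaleC :: "complex \<Rightarrow> 'a \<Rightarrow> 'a"  (infixr "*\<^sub>C" 75)
  assumes scaleC_of_real: "complex_of_real r *\<^sub>C x = r *\<^sub>R x"
    and scaleC_add_right: "c *\<^sub>C (x + y) = c *\<^sub>C x + c *\<^sub>C y"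
    and scaleC_add_left: "(b + c) *\<^sub>C x = b *\<^sub>C x + c *\<^sub>C x"
    and scaleC_scaleC: "b *\<^sub>C (c *\<^sub>C x) = (b * c) *\<^sub>C x"
    and mult_scaleC_left: "(c *\<^sub>C x) * y = c *\<^sub>C (x * y)"
    and mult_scaleC_right: "x * (c *\<^sub>C y) = c *\<^sub>C (x * y)"
    and norm_scaleC: "norm (c *\<^sub>C x) = cmod c * norm x"

class proper_banach_star_algebra = complex_banach_algebra_1 +
  fixes star :: "'a \<Rightarrow> 'a"  ("(_\<^sup>\<star>)" [1000] 999)
  assumes star_add: "(x + y)\<^sup>\<star> = x\<^sup>\<star> + y\<^sup>\<star>"
    and star_scaleC: "(c *\<^sub>C x)\<^sup>\<star> = cnj c *\<^sub>C x\<^sup>\<star>"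
    and star_mult: "(x * y)\<^sup>\<star> = y\<^sup>\<star> * x\<^sup>\<star>"
    and star_star: "(x\<^sup>\<star>)\<^sup>\<star> = x"
    and star_proper: "x\<^sup>\<star> * x = 0 \<Longrightarrow> x = 0"

definition qnil :: "'a::real_normed_algebra_1 set" where
  "qnil = {x. (\<lambda>n. root n (norm (x ^ n))) \<longlonglongrightarrow> 0}"

definition right_group_invertible :: "'a::ring_1 set" where
  "right_group_invertible = {a. \<exists>x. a * x\<^sup>2 = x \<and> a\<^sup>2 * x = a * x * a \<and> a * x * a = a}"

definition gen_right_drazin_invertible :: "'a::real_normed_algebra_1 set" where
  "gen_right_drazin_invertible =
    {a. \<exists>x. a * x\<^sup>2 = x \<and> a\<^sup>2 * x = a * x * a \<and> a - a * x * a \<in> qnil}"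

text \<open>
  Unlike the elements witnessing membership in \<open>gen_right_drazin_invertible\<close>, a generalized
  right Drazin inverse is normalized by the additional equation \<open>x * a * x = x\<close>. It need not
  be unique, hence the relation.
\<close>

definition gen_right_drazin_inverse :: "'a::real_normed_algebra_1 \<Rightarrow> 'a \<Rightarrow> bool" where
  "gen_right_drazin_inverse a x \<longleftrightarrow>
    a * x\<^sup>2 = x \<and> x * a * x = x \<and> a\<^sup>2 * x = a * x * a \<and> a - a * x * a \<in> qnil"

lemma gen_right_drazin_inverse_exists:
  assumes "a \<in> gen_right_drazin_invertible"
  shows "\<exists>x. gen_right_drazin_inverse a x"
proof -
  obtain x where x: "a * (x * x) = x" "a * (a * x) = a * (x * a)" "a - a * x * a \<in> qnil"
    using assms by (auto simp: gen_right_drazin_invertible_def power2_eq_square mult.assoc)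
  have xx: "a * (x * (x * z)) = x * z" for z
    using x(1) by (metis mult.assoc)
  have comm: "a * (x * (a * z)) = a * (a * (x * z))" for z
    using x(2) by (metis mult.assoc)
  have ax: "a * (x * (a * x)) = a * x"
    by (simp add: comm x(1))
  have ax': "a * (x * (a * (x * z))) = a * (x * z)" for z
    using ax by (metis mult.assoc)
  have "gen_right_drazin_inverse a (x * a * x)"
    unfolding gen_right_drazin_inverse_def power2_eq_square mult.assoc
    using x(2,3) by (simp add: ax ax' xx mult.assoc)
  then show ?thesis ..
qed

definition has_gen_right_group_decomposition :: "'a::proper_banach_star_algebra \<Rightarrow> bool" where
  "has_gen_right_group_decomposition a \<longleftrightarrow>
    (\<exists>a1 a2. a = a1 + a2 \<and> a1\<^sup>\<star> * a2 = 0 \<and> a2 * a1 = 0 \<and>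
       a1 \<in> right_group_invertible \<and> a2 \<in> qnil)"

end

theory Submission
  imports Defs
begin

text \<open>
  Call a sequence root-null if the \<open>n\<close>-th root of the norm of its \<open>n\<close>-th term tends to 0. Such a
  sequence beats every geometric growth, and the proof uses this in two ways.

  First, \<open>x = a * x\<^sup>2\<close> gives \<open>x = a ^ n * x ^ (n + 1)\<close> for every \<open>n\<close>. So if \<open>a ^ n - q * a ^ n\<close> is
  root-null, then \<open>q\<close> fixes \<open>x\<close> and every \<open>a ^ k * x\<close> from the left
  (\<open>root_null_imp_left_fixes\<close>). With \<open>q = a * x\<close>, these identities make \<open>a\<close> upper triangular with
  respect to the idempotent \<open>a * x\<close>: the summands \<open>a\<^sup>2 * x\<close> and \<open>a - a\<^sup>2 * x\<close> are right group
  invertible and quasinilpotent respectively, and the second annihilates the first from the left.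
  Conversely, a right group inverse \<open>x\<close> of the first summand of a decomposition recovers that
  summand as \<open>a\<^sup>2 * x\<close>. Hence a decomposition exists iff some \<open>x\<close> with \<open>x = a * x\<^sup>2\<close> and
  \<open>a ^ n - a * x * a ^ n\<close> root-null has the orthogonality
  \<open>(a\<^sup>2 * x)\<^sup>\<star> * (a - a\<^sup>2 * x) = 0\<close> (\<open>decomposition_iff_orthogonal_core\<close>). The self-adjointness
  in (2) restates this orthogonality. So does the equation in (3), because the first principle,
  applied to \<open>x\<close> and to the generalized right Drazin inverse \<open>z\<close> in turn, shows that \<open>a\<^sup>2 * x\<close> and
  \<open>a * z\<close> generate the same right ideal.

  Second, if \<open>b\<close> is quasinilpotent, then \<open>\<Sum>k. x ^ (k + 1) * b ^ k\<close> converges for every \<open>x\<close>. For a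
  decomposition \<open>a = a1 + a2\<close> and a right group inverse \<open>x\<close> of \<open>a1\<close>, this series with \<open>b = a2\<close> is a
  generalized right Drazin inverse of \<open>a\<close> (\<open>decomposition_imp_gen_right_drazin_invertible\<close>), which
  is the remaining assertion of (3).
\<close>

section \<open>Sequences that decay faster than every geometric sequence\<close>

definition root_null :: "(nat \<Rightarrow> 'a::real_normed_vector) \<Rightarrow> bool" where
  "root_null f \<longleftrightarrow> (\<lambda>n. root n (norm (f n))) \<longlonglongrightarrow> 0"

lemma qnil_iff_root_null: "a \<in> qnil \<longleftrightarrow> root_null (\<lambda>n. a ^ n)"
  by (simp add: qnil_def root_null_def)

lemma root_null_iff_beats_geometric:
  "root_null f \<longleftrightarrow> (\<forall>c>0. (\<lambda>n. c ^ n * norm (f n)) \<longlonglongrightarrow> 0)"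
proof (intro iffI allI impI)
  fix c :: real
  assume f: "root_null f" and c: "c > 0"
  have "\<forall>\<^sub>F n in sequentially. root n (norm (f n)) < 1 / (2 * c)"
    using f c unfolding root_null_def by (intro order_tendstoD(2)) auto
  then have "\<forall>\<^sub>F n in sequentially. norm (c ^ n * norm (f n)) \<le> (1 / 2) ^ n"
    using eventually_gt_at_top[of 0]
  proof eventually_elim
    case (elim n)
    have "norm (f n) = root n (norm (f n)) ^ n"
      using elim by simp
    also have "\<dots> \<le> (1 / (2 * c)) ^ n"
      using elim by (intro power_mono) auto
    finally have "c ^ n * norm (f n) \<le> c ^ n * (1 / (2 * c)) ^ n"
      using c by (intro mult_left_mono) auto
    also have "\<dots> = (1 / 2) ^ n"
      using c by (simp flip: power_mult_distrib)
    finally show ?case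
      using c by simp
  qed
  then show "(\<lambda>n. c ^ n * norm (f n)) \<longlonglongrightarrow> 0"
    by (rule Lim_null_comparison) (intro LIMSEQ_power_zero, simp)
next
  assume f: "\<forall>c>0. (\<lambda>n. c ^ n * norm (f n)) \<longlonglongrightarrow> 0"
  show "root_null f"
    unfolding root_null_def
  proof (rule order_tendstoI)
    fix e :: real
    assume "e < 0"
    then show "\<forall>\<^sub>F n in sequentially. e < root n (norm (f n))"
      by (intro always_eventually allI) (rule less_le_trans, assumption, simp add: real_root_ge_zero)
  next
    fix e :: real
    assume e: "0 < e"
    have "(\<lambda>n. (1 / e) ^ n * norm (f n)) \<longlonglongrightarrow> 0"
      using f[rule_format, of "1 / e"] e by simp
    then have "\<forall>\<^sub>F n in sequentially. (1 / e) ^ n * norm (f n) < 1"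
      by (rule order_tendstoD) simp
    then show "\<forall>\<^sub>F n in sequentially. root n (norm (f n)) < e"
      using eventually_gt_at_top[of 0]
    proof eventually_elim
      case (elim n)
      then have "norm (f n) < e ^ n"
        using e by (simp add: power_divide field_simps)
      then have "root n (norm (f n)) < root n (e ^ n)"
        using elim by (simp add: real_root_less_iff)
      then show ?case
        using elim e by (simp add: real_root_power_cancel)
    qed
  qed
qed

lemma root_null_mult_left:
  fixes f :: "nat \<Rightarrow> 'a::real_normed_algebra"
  assumes "root_null f"
  shows "root_null (\<lambda>n. b * f n)"
  unfolding root_null_iff_beats_geometric
proof (intro allI impI)
  fix c :: real
  assume c: "c > 0"
  have "(\<lambda>n. norm b * (c ^ n * norm (f n))) \<longlonglongrightarrow> 0"
    using assms c by (intro tendsto_mult_right_zero) (simp add: root_null_iff_beats_geometric)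
  moreover have "\<forall>n. norm (c ^ n * norm (b * f n)) \<le> norm b * (c ^ n * norm (f n))"
    using c norm_mult_ineq[of b] by (simp add: abs_mult mult.left_commute)
  ultimately show "(\<lambda>n. c ^ n * norm (b * f n)) \<longlonglongrightarrow> 0"
    by (rule Lim_null_comparison[OF always_eventually, rotated])
qed

lemma root_null_cong_Suc:
  assumes "root_null f" and "\<And>n. g (Suc n) = f (Suc n)"
  shows "root_null g"
proof -
  have "(\<lambda>n. root (Suc n) (norm (f (Suc n)))) \<longlonglongrightarrow> 0"
    using assms(1) unfolding root_null_def by (rule LIMSEQ_Suc)
  then have "(\<lambda>n. root (Suc n) (norm (g (Suc n)))) \<longlonglongrightarrow> 0"
    by (simp only: assms(2))
  then show ?thesis
    unfolding root_null_def by (rule LIMSEQ_imp_Suc)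
qed

lemma root_null_Suc:
  assumes "root_null (\<lambda>n. f (Suc n))"
  shows "root_null f"
  unfolding root_null_iff_beats_geometric
proof (intro allI impI)
  fix c :: real
  assume "c > 0"
  then have "(\<lambda>n. c * (c ^ n * norm (f (Suc n)))) \<longlonglongrightarrow> 0"
    using assms by (intro tendsto_mult_right_zero) (simp add: root_null_iff_beats_geometric)
  then have "(\<lambda>n. c ^ Suc n * norm (f (Suc n))) \<longlonglongrightarrow> 0"
    by (simp add: mult.assoc)
  then show "(\<lambda>n. c ^ n * norm (f n)) \<longlonglongrightarrow> 0"
    by (rule LIMSEQ_imp_Suc)
qed

text \<open>
  Since \<open>x = a ^ n * x ^ (n + 1)\<close>, the element \<open>a ^ k * x - q * a ^ k * x\<close> factors through
  \<open>a ^ n - q * a ^ n\<close> for every \<open>n\<close>, at the cost of a factor of only geometric size.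
\<close>

lemma root_null_imp_left_fixes:
  fixes a q x :: "'a::real_normed_algebra_1"
  assumes x: "a * x\<^sup>2 = x" and decay: "root_null (\<lambda>n. a ^ n - q * a ^ n)"
  shows "q * a ^ k * x = a ^ k * x"
proof -
  have iter: "a ^ n * x ^ Suc n = x" for n
  proof (induction n)
    case (Suc n)
    have "a ^ Suc n * x ^ Suc (Suc n) = a ^ n * (a * x\<^sup>2) * x ^ n"
      by (simp only: power_Suc2[of a n] power_Suc[of x] power2_eq_square mult.assoc)
    also have "\<dots> = x"
      unfolding x using Suc by (simp add: mult.assoc)
    finally show ?case .
  qed simp
  have bound: "norm (a ^ k * x - q * a ^ k * x) \<le>
      norm (a ^ k) * norm x * ((norm x + 1) ^ n * norm (a ^ n - q * a ^ n))" (is "?l \<le> _") for n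
  proof -
    have "a ^ k * x = a ^ k * (a ^ n * x ^ Suc n)"
      by (simp only: iter)
    also have "\<dots> = a ^ n * (a ^ k * x ^ Suc n)"
      by (simp only: mult.assoc[symmetric] power_add[symmetric] add.commute)
    finally have "a ^ k * x = a ^ n * (a ^ k * x ^ Suc n)" .
    then have "a ^ k * x - q * a ^ k * x = (a ^ n - q * a ^ n) * (a ^ k * x ^ Suc n)"
      by (simp only: left_diff_distrib mult.assoc)
    then have "?l \<le> norm (a ^ n - q * a ^ n) * norm (a ^ k * x ^ Suc n)"
      by (simp only: norm_mult_ineq)
    moreover have "norm (a ^ k * x ^ Suc n) \<le> norm (a ^ k) * (norm x * (norm x + 1) ^ n)"
    proof -
      have "norm (x ^ Suc n) \<le> norm x * norm x ^ n"
        using norm_power_ineq[of x "Suc n"] by simp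
      also have "\<dots> \<le> norm x * (norm x + 1) ^ n"
        by (intro mult_left_mono power_mono) auto
      finally show ?thesis
        by (intro order.trans[OF norm_mult_ineq] mult_left_mono) auto
    qed
    ultimately have "?l \<le> norm (a ^ n - q * a ^ n) *
        (norm (a ^ k) * (norm x * (norm x + 1) ^ n))"
      by (meson mult_left_mono norm_ge_zero order.trans)
    then show ?thesis
      by (simp only: mult_ac)
  qed
  have "norm x + 1 > 0"
    by (simp add: add_nonneg_pos)
  then have "(\<lambda>n. norm (a ^ k) * norm x * ((norm x + 1) ^ n * norm (a ^ n - q * a ^ n))) \<longlonglongrightarrow> 0"
    using decay by (intro tendsto_mult_right_zero) (simp add: root_null_iff_beats_geometric)
  then have "?l \<le> 0"
    by (rule LIMSEQ_le_const) (use bound in blast)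
  then show ?thesis
    by simp
qed

lemma summable_powers_qnil:
  fixes b x :: "'a::{real_normed_algebra_1, banach}"
  assumes "b \<in> qnil"
  shows "summable (\<lambda>k. x ^ Suc k * b ^ k)"
proof -
  \<comment> \<open>The summand 1 keeps the base positive when \<open>x = 0\<close>; the factor 2 below turns the bound
    into a convergent geometric series.\<close>
  let ?c = "norm x + 1"
  have c: "?c > 0"
    by (simp add: add_nonneg_pos)
  then have "(\<lambda>k. (2 * ?c) ^ k * norm (b ^ k)) \<longlonglongrightarrow> 0"
    using assms by (simp add: qnil_iff_root_null root_null_iff_beats_geometric)
  then have "\<forall>\<^sub>F k in sequentially. (2 * ?c) ^ k * norm (b ^ k) < 1"
    by (rule order_tendstoD) simp
  then have "\<forall>\<^sub>F k in sequentially. norm (x ^ Suc k * b ^ k) \<le> ?c * (1 / 2) ^ k"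
  proof eventually_elim
    case (elim k)
    have "norm (x ^ Suc k * b ^ k) \<le> norm x ^ Suc k * norm (b ^ k)"
      by (rule order.trans[OF norm_mult_ineq]) (intro mult_right_mono norm_power_ineq, simp)
    also have "\<dots> \<le> ?c ^ Suc k * norm (b ^ k)"
      by (intro mult_right_mono power_mono) auto
    also have "\<dots> = ?c * (1 / 2) ^ k * ((2 * ?c) ^ k * norm (b ^ k))"
    proof -
      have "?c ^ k = (1 / 2) ^ k * (2 * ?c) ^ k"
        by (simp only: power_mult_distrib[symmetric] mult.assoc[symmetric]) simp
      then show ?thesis
        by (simp only: power_Suc mult.assoc)
    qed
    also have "\<dots> \<le> ?c * (1 / 2) ^ k * 1"
      using elim c by (intro mult_left_mono) auto
    finally show ?case
      by simp
  qed
  then show ?thesis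
    by (rule summable_comparison_test_ev) (intro summable_mult summable_geometric, simp)
qed

section \<open>Decompositions and their orthogonality condition\<close>

lemma right_group_decomposition_identities:
  fixes a1 a2 x :: "'a::ring_1"
  assumes x: "a1 * x\<^sup>2 = x" "a1\<^sup>2 * x = a1" and ann: "a2 * a1 = 0"
  shows "a2 * x = 0" "(a1 + a2) * x = a1 * x" "(a1 + a2) * x\<^sup>2 = x" "(a1 + a2)\<^sup>2 * x = a1"
proof -
  show *: "a2 * x = 0"
    using x(1) ann by (metis mult.assoc mult_zero_left)
  then show ax: "(a1 + a2) * x = a1 * x"
    by (simp add: distrib_right)
  then show "(a1 + a2) * x\<^sup>2 = x"
    using x(1) by (simp add: power2_eq_square flip: mult.assoc)
  have "(a1 + a2)\<^sup>2 * x = (a1 + a2) * (a1 * x)"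
    by (simp add: power2_eq_square mult.assoc ax)
  also have "\<dots> = a1 * (a1 * x) + a2 * a1 * x"
    by (simp add: distrib_right mult.assoc)
  also have "\<dots> = a1"
    using x(2) ann by (simp add: power2_eq_square mult.assoc)
  finally show "(a1 + a2)\<^sup>2 * x = a1" .
qed

text \<open>
  The powers of \<open>a = a1 + a2\<close> satisfy \<open>a2 * a ^ n = a2 ^ (n + 1)\<close>, and \<open>1 - a1 * x\<close> kills \<open>a1\<close>, so
  that \<open>a ^ n - a * x * a ^ n = (1 - a1 * x) * a2 ^ n\<close> from \<open>n = 1\<close> on.
\<close>

lemma right_group_decomposition_root_null:
  fixes a1 a2 x :: "'a::real_normed_algebra_1"
  assumes x: "a1 * x\<^sup>2 = x" "a1\<^sup>2 * x = a1" "a1 * x * a1 = a1" and ann: "a2 * a1 = 0"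
    and a2: "a2 \<in> qnil"
  shows "root_null (\<lambda>n. (a1 + a2) ^ n - (a1 + a2) * x * (a1 + a2) ^ n)"
proof -
  note ax = right_group_decomposition_identities(2)[OF x(1,2) ann]
  have pow: "a2 * (a1 + a2) ^ n = a2 ^ Suc n" for n
  proof (induction n)
    case (Suc n)
    have "a2 * (a1 + a2) ^ Suc n = (a2 * a1 + a2 * a2) * (a1 + a2) ^ n"
      by (simp add: distrib_left flip: mult.assoc)
    also have "\<dots> = a2 ^ Suc (Suc n)"
      using Suc by (simp add: ann mult.assoc)
    finally show ?case .
  qed simp
  have "(a1 + a2) ^ Suc n - (a1 + a2) * x * (a1 + a2) ^ Suc n = (1 - a1 * x) * a2 ^ Suc n" for n
  proof -
    have "(a1 + a2) ^ Suc n - (a1 + a2) * x * (a1 + a2) ^ Suc n =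
        (1 - a1 * x) * (a1 + a2) * (a1 + a2) ^ n"
      by (simp add: ax left_diff_distrib mult.assoc)
    also have "(1 - a1 * x) * (a1 + a2) = (1 - a1 * x) * a2"
      using x(3) by (simp add: algebra_simps)
    finally show ?thesis
      by (simp add: mult.assoc pow)
  qed
  moreover have "root_null (\<lambda>n. (1 - a1 * x) * a2 ^ n)"
    using a2 by (simp add: qnil_iff_root_null root_null_mult_left)
  ultimately show ?thesis
    by (rule root_null_cong_Suc[rotated])
qed

text \<open>
  The idempotent is \<open>a * x\<close>; it fixes every \<open>a ^ k * x\<close>, so that
  \<open>(a - a\<^sup>2 * x) ^ (n + 2) = a * (1 - a * x) * a ^ (n + 1)\<close>, and the hypothesis on
  \<open>a ^ n - a * x * a ^ n\<close> becomes quasinilpotence of \<open>a - a\<^sup>2 * x\<close>.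
\<close>

lemma right_group_decomposition_of_root_null:
  fixes a x :: "'a::real_normed_algebra_1"
  assumes x: "a * x\<^sup>2 = x" and decay: "root_null (\<lambda>n. a ^ n - a * x * a ^ n)"
  shows "a * x * a * x = a * x" "a\<^sup>2 * x \<in> right_group_invertible"
    and "(a - a\<^sup>2 * x) * (a\<^sup>2 * x) = 0" "a - a\<^sup>2 * x \<in> qnil"
proof -
  note fixes_ = root_null_imp_left_fixes[OF x decay]
  show f1: "a * x * a * x = a * x"
    using fixes_[of 1] by simp
  have xx: "a * (x * x) = x"
    using x by (simp add: power2_eq_square)
  have xx': "a * (x * (x * z)) = x * z" for z
    using xx by (metis mult.assoc)
  have f1': "a * (x * (a * x)) = a * x"
    using f1 by (simp add: mult.assoc)
  have f2: "a * (x * (a * (a * x))) = a * (a * x)"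
    using fixes_[of 2] by (simp add: power2_eq_square mult.assoc)
  show "a\<^sup>2 * x \<in> right_group_invertible"
    unfolding right_group_invertible_def mem_Collect_eq
    by (rule exI[of _ x]) (simp add: power2_eq_square mult.assoc xx xx' f1' f2)
  show "(a - a\<^sup>2 * x) * (a\<^sup>2 * x) = 0"
    by (simp add: power2_eq_square mult.assoc left_diff_distrib f2)
  have step: "a * (b - a * x * b) * (a - a\<^sup>2 * x) =
      a * (b * a - a * x * (b * a)) - a * (b * a * a * x - a * x * (b * a * a) * x)" for b
    by (simp add: algebra_simps power2_eq_square)
  have pow: "(a - a\<^sup>2 * x) ^ Suc (Suc n) = a * (a ^ Suc n - a * x * a ^ Suc n)" for n
  proof (induction n)
    case 0
    show ?case
      by (simp add: power2_eq_square mult.assoc algebra_simps f2)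
  next
    case (Suc n)
    have "(a - a\<^sup>2 * x) ^ Suc (Suc (Suc n)) = a * (a ^ Suc n - a * x * a ^ Suc n) * (a - a\<^sup>2 * x)"
      using Suc by (metis power_Suc2)
    also have "\<dots> = a * (a ^ Suc (Suc n) - a * x * a ^ Suc (Suc n)) -
        a * (a ^ Suc (Suc (Suc n)) * x - a * x * a ^ Suc (Suc (Suc n)) * x)"
      using step[of "a ^ Suc n"] by (simp only: power_Suc2)
    also have "\<dots> = a * (a ^ Suc (Suc n) - a * x * a ^ Suc (Suc n))"
      by (simp only: fixes_) simp
    finally show ?case .
  qed
  have "root_null (\<lambda>n. (a - a\<^sup>2 * x) ^ Suc n)"
    using root_null_mult_left[OF decay, of a] pow by (rule root_null_cong_Suc)
  then show "a - a\<^sup>2 * x \<in> qnil"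
    unfolding qnil_iff_root_null by (rule root_null_Suc)
qed

lemma decomposition_iff_orthogonal_core:
  fixes a :: "'a::proper_banach_star_algebra"
  shows "has_gen_right_group_decomposition a \<longleftrightarrow>
    (\<exists>x. a * x\<^sup>2 = x \<and> root_null (\<lambda>n. a ^ n - a * x * a ^ n) \<and>
      (a\<^sup>2 * x)\<^sup>\<star> * (a - a\<^sup>2 * x) = 0)"
proof
  assume "has_gen_right_group_decomposition a"
  then obtain a1 a2 x where a: "a = a1 + a2" "a1\<^sup>\<star> * a2 = 0" "a2 * a1 = 0" "a2 \<in> qnil"
    and x: "a1 * x\<^sup>2 = x" "a1\<^sup>2 * x = a1" "a1 * x * a1 = a1"
    unfolding has_gen_right_group_decomposition_def right_group_invertible_def by auto
  note ids = right_group_decomposition_identities[OF x(1,2) a(3)]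
  show "\<exists>x. a * x\<^sup>2 = x \<and> root_null (\<lambda>n. a ^ n - a * x * a ^ n) \<and>
      (a\<^sup>2 * x)\<^sup>\<star> * (a - a\<^sup>2 * x) = 0"
    using right_group_decomposition_root_null[OF x a(3,4)] ids(3,4) a(1,2)
    by (intro exI[of _ x]) simp
next
  assume "\<exists>x. a * x\<^sup>2 = x \<and> root_null (\<lambda>n. a ^ n - a * x * a ^ n) \<and>
      (a\<^sup>2 * x)\<^sup>\<star> * (a - a\<^sup>2 * x) = 0"
  then obtain x where x: "a * x\<^sup>2 = x" "root_null (\<lambda>n. a ^ n - a * x * a ^ n)"
    and orth: "(a\<^sup>2 * x)\<^sup>\<star> * (a - a\<^sup>2 * x) = 0"
    by blast
  have "a = a\<^sup>2 * x + (a - a\<^sup>2 * x)"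
    by simp
  then show "has_gen_right_group_decomposition a"
    unfolding has_gen_right_group_decomposition_def
    using orth right_group_decomposition_of_root_null(2-4)[OF x] by blast
qed

text \<open>
  Orthogonality says that \<open>(a\<^sup>2 * x)\<^sup>\<star> * a\<close> equals the self-adjoint \<open>(a\<^sup>2 * x)\<^sup>\<star> * (a\<^sup>2 * x)\<close>. In the
  other direction, self-adjointness moves \<open>a\<^sup>2 * x\<close> next to \<open>1 - a * x\<close>, which it annihilates.
\<close>

lemma orthogonal_iff_self_adjoint:
  fixes a x :: "'a::proper_banach_star_algebra"
  assumes idem: "a * x * a * x = a * x"
  shows "(a\<^sup>2 * x)\<^sup>\<star> * (a - a\<^sup>2 * x) = 0 \<longleftrightarrow> (a\<^sup>\<star> * a\<^sup>2 * x)\<^sup>\<star> = a\<^sup>\<star> * a\<^sup>2 * x"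
proof
  assume "(a\<^sup>2 * x)\<^sup>\<star> * (a - a\<^sup>2 * x) = 0"
  then have *: "(a\<^sup>2 * x)\<^sup>\<star> * a = (a\<^sup>2 * x)\<^sup>\<star> * (a\<^sup>2 * x)"
    by (simp add: right_diff_distrib)
  then have "((a\<^sup>2 * x)\<^sup>\<star> * a)\<^sup>\<star> = (a\<^sup>2 * x)\<^sup>\<star> * a"
    by (metis star_mult star_star)
  then show "(a\<^sup>\<star> * a\<^sup>2 * x)\<^sup>\<star> = a\<^sup>\<star> * a\<^sup>2 * x"
    by (metis mult.assoc star_mult star_star)
next
  assume "(a\<^sup>\<star> * a\<^sup>2 * x)\<^sup>\<star> = a\<^sup>\<star> * a\<^sup>2 * x"
  then have *: "(a\<^sup>2 * x)\<^sup>\<star> * a = a\<^sup>\<star> * (a\<^sup>2 * x)"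
    by (metis mult.assoc star_mult star_star)
  have "(a\<^sup>2 * x)\<^sup>\<star> * (a - a\<^sup>2 * x) = (a\<^sup>2 * x)\<^sup>\<star> * a * (1 - a * x)"
    by (simp add: power2_eq_square right_diff_distrib mult.assoc)
  also have "\<dots> = a\<^sup>\<star> * a * (a * x - a * x * a * x)"
    unfolding * by (simp add: power2_eq_square right_diff_distrib mult.assoc)
  finally show "(a\<^sup>2 * x)\<^sup>\<star> * (a - a\<^sup>2 * x) = 0"
    by (simp add: idem)
qed

section \<open>Generalized right Drazin inverses\<close>

text \<open>
  Here \<open>a * z\<close> is an idempotent that commutes with \<open>a\<close>, so \<open>a ^ n - a * z * a ^ n\<close> is the \<open>n\<close>-th
  power of the quasinilpotent \<open>a - a * z * a\<close>.
\<close>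

lemma gen_right_drazin_inverse_root_null:
  fixes a z :: "'a::real_normed_algebra_1"
  assumes "gen_right_drazin_inverse a z"
  shows "root_null (\<lambda>n. a ^ n - a * z * a ^ n)"
proof -
  have zaz: "z * (a * z) = z" and comm: "a * (z * a) = a * (a * z)" and nil: "a - a * z * a \<in> qnil"
    using assms by (auto simp: gen_right_drazin_inverse_def power2_eq_square mult.assoc)
  let ?p = "1 - a * z"
  have pap: "?p * a * ?p = ?p * a"
  proof -
    have "a * (z * (a * (a * z))) = a * (a * z)"
      using comm zaz by (metis mult.assoc)
    then show ?thesis
      by (simp add: algebra_simps mult.assoc)
  qed
  have pow: "(?p * a) ^ Suc n = ?p * a ^ Suc n" for n
  proof (induction n)
    case (Suc n)
    have "(?p * a) ^ Suc (Suc n) = ?p * a * ?p * a ^ Suc n"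
      using Suc by (metis mult.assoc power_Suc)
    then show ?case
      unfolding pap by (simp add: mult.assoc)
  qed simp
  have "a - a * z * a = ?p * a"
    by (simp add: algebra_simps)
  then have "root_null (\<lambda>n. (?p * a) ^ n)"
    using nil by (simp add: qnil_iff_root_null)
  then show ?thesis
    by (rule root_null_cong_Suc) (subst pow, simp add: left_diff_distrib mult.assoc)
qed

text \<open>
  Both conditions say that a starred element kills \<open>a - a\<^sup>2 * x\<close> from the left, and each of the
  two elements is a right multiple of the other: \<open>a * z = (a\<^sup>2 * x) * z\<close> because \<open>a * x\<close> fixes \<open>z\<close>, and
  \<open>a\<^sup>2 * x = (a * z) * (a\<^sup>2 * x)\<close> because \<open>a * z\<close> fixes \<open>a\<^sup>2 * x\<close>.
\<close>

lemma orthogonal_iff_drazin_orthogonal: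
  fixes a x z :: "'a::proper_banach_star_algebra"
  assumes x: "a * x\<^sup>2 = x" "root_null (\<lambda>n. a ^ n - a * x * a ^ n)"
    and z: "gen_right_drazin_inverse a z"
  shows "(a\<^sup>2 * x)\<^sup>\<star> * (a - a\<^sup>2 * x) = 0 \<longleftrightarrow> (a * z)\<^sup>\<star> * a\<^sup>2 * x = (a * z)\<^sup>\<star> * a"
proof -
  have az2: "a * z\<^sup>2 = z"
    using z by (simp add: gen_right_drazin_inverse_def)
  have "a * x * z = z"
    using root_null_imp_left_fixes[OF az2 x(2), of 0] by simp
  then have az: "a * z = a\<^sup>2 * x * z"
    by (simp add: power2_eq_square mult.assoc)
  have ax: "a\<^sup>2 * x = a * z * (a\<^sup>2 * x)"
    using root_null_imp_left_fixes[OF x(1) gen_right_drazin_inverse_root_null[OF z], of 2]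
    by (simp add: mult.assoc)
  have "(a\<^sup>2 * x)\<^sup>\<star> * (a - a\<^sup>2 * x) = 0 \<longleftrightarrow> (a * z)\<^sup>\<star> * (a - a\<^sup>2 * x) = 0"
  proof
    assume orth: "(a\<^sup>2 * x)\<^sup>\<star> * (a - a\<^sup>2 * x) = 0"
    have "(a * z)\<^sup>\<star> * (a - a\<^sup>2 * x) = z\<^sup>\<star> * ((a\<^sup>2 * x)\<^sup>\<star> * (a - a\<^sup>2 * x))"
      by (subst az, subst star_mult) (rule mult.assoc)
    then show "(a * z)\<^sup>\<star> * (a - a\<^sup>2 * x) = 0"
      by (simp add: orth)
  next
    assume orth: "(a * z)\<^sup>\<star> * (a - a\<^sup>2 * x) = 0"
    have "(a\<^sup>2 * x)\<^sup>\<star> = (a\<^sup>2 * x)\<^sup>\<star> * (a * z)\<^sup>\<star>"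
      using ax star_mult by metis
    then have "(a\<^sup>2 * x)\<^sup>\<star> * (a - a\<^sup>2 * x) = (a\<^sup>2 * x)\<^sup>\<star> * ((a * z)\<^sup>\<star> * (a - a\<^sup>2 * x))"
      by (metis mult.assoc)
    then show "(a\<^sup>2 * x)\<^sup>\<star> * (a - a\<^sup>2 * x) = 0"
      by (simp only: orth mult_zero_right)
  qed
  then show ?thesis
    by (auto simp: right_diff_distrib mult.assoc)
qed

text \<open>
  The witness is \<open>y = (\<Sum>k. x ^ (k + 1) * a2 ^ k)\<close>. Since \<open>a\<close> times \<open>x ^ (k + 1)\<close> is \<open>x ^ k\<close> for
  \<open>k \<ge> 1\<close>, the series telescopes to \<open>a * y = a1 * x + y * a2\<close>; this, \<open>a1 * x * y = y\<close> and
  \<open>a2 * y = 0\<close> are all that the three defining properties require.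
\<close>

lemma decomposition_imp_gen_right_drazin_invertible:
  fixes a :: "'a::proper_banach_star_algebra"
  assumes "has_gen_right_group_decomposition a"
  shows "a \<in> gen_right_drazin_invertible"
proof -
  obtain a1 a2 x where a: "a = a1 + a2" "a2 * a1 = 0" "a2 \<in> qnil"
    and x: "a1 * x\<^sup>2 = x" "a1\<^sup>2 * x = a1" "a1 * x * a1 = a1"
    using assms unfolding has_gen_right_group_decomposition_def right_group_invertible_def by auto
  note ids = right_group_decomposition_identities[OF x(1,2) a(2)]
  define t where "t k = x ^ Suc k * a2 ^ k" for k
  define y where "y = suminf t"
  have t: "summable t"
    unfolding t_def using a(3) by (rule summable_powers_qnil)
  have xpow: "a1 * x ^ Suc (Suc k) = x ^ Suc k" for k
    using x(1) by (metis mult.assoc power2_eq_square power_Suc)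
  have a2y: "a2 * y = 0"
    using ids(1) by (simp add: y_def suminf_mult[OF t, symmetric] t_def flip: mult.assoc)
  have a1xy: "a1 * x * y = y"
  proof -
    have "a1 * x * t k = t k" for k
      unfolding t_def using xpow[of k] by (metis mult.assoc power_Suc)
    then show ?thesis
      by (simp add: y_def suminf_mult[OF t, symmetric])
  qed
  have ay: "a * y = a1 * x + y * a2"
  proof -
    have shift: "a1 * t (Suc k) = t k * a2" for k
      unfolding t_def using xpow[of k] by (metis mult.assoc power_Suc2)
    have "(\<Sum>k. a1 * t (Suc k)) = (\<Sum>k. a1 * t k) - a1 * t 0"
      by (rule suminf_split_head[OF summable_mult[OF t]])
    then have "y * a2 = a1 * y - a1 * t 0"
      by (simp only: shift y_def suminf_mult[OF t] suminf_mult2[OF t])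
    then have "a1 * y = a1 * x + y * a2"
      by (simp add: t_def)
    then show ?thesis
      by (simp add: a(1) distrib_right a2y)
  qed
  have aay: "a * (a * y) = a1 + a * y * a2"
  proof -
    have "a * (a * y) = a * (a1 * x + y * a2)"
      by (simp only: ay)
    also have "\<dots> = a * (a1 * x) + a * y * a2"
      by (simp only: distrib_left mult.assoc)
    also have "a * (a1 * x) = a\<^sup>2 * x"
      unfolding a(1) ids(2)[symmetric] by (simp add: power2_eq_square mult.assoc)
    also have "\<dots> = a1"
      using ids(4) by (simp only: a(1))
    finally show ?thesis .
  qed
  have aya: "a * (y * a) = a1 + a * y * a2"
  proof -
    have "a * (y * a) = a * (y * (a1 + a2))"
      by (simp only: a(1)[symmetric])
    also have "\<dots> = a * y * a1 + a * y * a2"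
      by (simp only: distrib_left mult.assoc)
    also have "a * y * a1 = a1 * x * a1 + y * (a2 * a1)"
      by (simp only: ay distrib_right mult.assoc)
    also have "\<dots> = a1"
      by (simp add: x(3) a(2))
    finally show ?thesis .
  qed
  have "a * y\<^sup>2 = a * y * y"
    by (simp add: power2_eq_square mult.assoc)
  also have "\<dots> = a1 * x * y + y * (a2 * y)"
    by (simp only: ay distrib_right mult.assoc)
  also have "\<dots> = y"
    by (simp add: a1xy a2y)
  finally have "a * y\<^sup>2 = y" .
  moreover have "a\<^sup>2 * y = a * y * a"
    using aay aya by (simp add: power2_eq_square mult.assoc)
  moreover have "a - a * y * a \<in> qnil"
  proof -
    have eq: "a - a * y * a = (1 - a * y) * a2"
    proof -
      have "a - a1 = a2"
        by (simp add: a(1))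
      then show ?thesis
        using aya by (simp add: mult.assoc left_diff_distrib flip: diff_diff_eq)
    qed
    have "a2 * (a * y) = a2 * a1 * x + a2 * y * a2"
      by (simp add: ay distrib_left mult.assoc)
    then have "a2 * (a * y) = 0"
      by (simp add: a(2) a2y)
    then have absorb: "a2 * (1 - a * y) = a2"
      by (simp add: right_diff_distrib)
    have pow: "((1 - a * y) * a2) ^ Suc n = (1 - a * y) * a2 ^ Suc n" for n
    proof (induction n)
      case (Suc n)
      have "((1 - a * y) * a2) ^ Suc (Suc n) = (1 - a * y) * (a2 * (1 - a * y)) * a2 ^ Suc n"
        using Suc by (metis mult.assoc power_Suc)
      then show ?case
        unfolding absorb by (simp add: mult.assoc)
    qed simp
    have "root_null (\<lambda>n. (1 - a * y) * a2 ^ n)"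
      using a(3) by (simp add: qnil_iff_root_null root_null_mult_left)
    then show ?thesis
      unfolding eq qnil_iff_root_null using pow by (rule root_null_cong_Suc)
  qed
  ultimately show ?thesis
    unfolding gen_right_drazin_invertible_def by blast
qed

section \<open>The equivalences\<close>

theorem theorem2p6:
  fixes a ard :: "'a::proper_banach_star_algebra"
  assumes ard: "a \<in> gen_right_drazin_invertible \<Longrightarrow> gen_right_drazin_inverse a ard"
  shows "(has_gen_right_group_decomposition a \<longleftrightarrow>
      (\<exists>x. x = a * x\<^sup>2 \<and> (a\<^sup>\<star> * a\<^sup>2 * x)\<^sup>\<star> = a\<^sup>\<star> * a\<^sup>2 * x \<and>
        (\<lambda>n. root n (norm (a ^ n - a * x * a ^ n))) \<longlonglongrightarrow> 0)) \<and>
    (has_gen_right_group_decomposition a \<longleftrightarrow>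
      a \<in> gen_right_drazin_invertible \<and>
      (\<exists>x. x = a * x\<^sup>2 \<and> (a * ard)\<^sup>\<star> * a\<^sup>2 * x = (a * ard)\<^sup>\<star> * a \<and>
        (\<lambda>n. root n (norm (a ^ n - a * x * a ^ n))) \<longlonglongrightarrow> 0))"
proof (intro conjI)
  show "has_gen_right_group_decomposition a \<longleftrightarrow>
      (\<exists>x. x = a * x\<^sup>2 \<and> (a\<^sup>\<star> * a\<^sup>2 * x)\<^sup>\<star> = a\<^sup>\<star> * a\<^sup>2 * x \<and>
        (\<lambda>n. root n (norm (a ^ n - a * x * a ^ n))) \<longlonglongrightarrow> 0)"
    unfolding decomposition_iff_orthogonal_core root_null_def[symmetric]
  proof (rule iff_exI)
    fix x
    show "(a * x\<^sup>2 = x \<and> root_null (\<lambda>n. a ^ n - a * x * a ^ n) \<and>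
        (a\<^sup>2 * x)\<^sup>\<star> * (a - a\<^sup>2 * x) = 0) \<longleftrightarrow>
      (x = a * x\<^sup>2 \<and> (a\<^sup>\<star> * a\<^sup>2 * x)\<^sup>\<star> = a\<^sup>\<star> * a\<^sup>2 * x \<and>
        root_null (\<lambda>n. a ^ n - a * x * a ^ n))"
      using orthogonal_iff_self_adjoint[OF right_group_decomposition_of_root_null(1), of a x]
        eq_commute[of x "a * x\<^sup>2"] by blast
  qed
next
  show "has_gen_right_group_decomposition a \<longleftrightarrow>
      a \<in> gen_right_drazin_invertible \<and>
      (\<exists>x. x = a * x\<^sup>2 \<and> (a * ard)\<^sup>\<star> * a\<^sup>2 * x = (a * ard)\<^sup>\<star> * a \<and>
        (\<lambda>n. root n (norm (a ^ n - a * x * a ^ n))) \<longlonglongrightarrow> 0)"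
  proof (cases "a \<in> gen_right_drazin_invertible")
    case True
    have "(a * x\<^sup>2 = x \<and> root_null (\<lambda>n. a ^ n - a * x * a ^ n) \<and>
        (a\<^sup>2 * x)\<^sup>\<star> * (a - a\<^sup>2 * x) = 0) \<longleftrightarrow>
      (x = a * x\<^sup>2 \<and> (a * ard)\<^sup>\<star> * a\<^sup>2 * x = (a * ard)\<^sup>\<star> * a \<and>
        root_null (\<lambda>n. a ^ n - a * x * a ^ n))" for x
      using orthogonal_iff_drazin_orthogonal[OF _ _ ard[OF True], of x]
        eq_commute[of x "a * x\<^sup>2"] by blast
    with True show ?thesis
      unfolding decomposition_iff_orthogonal_core root_null_def[symmetric] by simp
  next
    case False
    then show ?thesis
      using decomposition_imp_gen_right_drazin_invertible by blast
  qed
qed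

end
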